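(* Let $r_1,r_2\in\mathbb{Z}$ and let $(U_n)_{n\ge0}$ be a sequence of integers with $U_n=r_1U_{n-1}+r_2U_{n-2}$ for all $n\ge2$. Let $\alpha,\beta$ be the roots of $x^2-r_1x-r_2$, assume $\alpha\neq\beta$, and assume $\Delta=(\alpha-\beta)^2=r_1^2+4r_2$ is the square of an integer. Then the sequence $(r_2\operatorname{rad}(\Delta)U_n)_{n\ge1}$ satisfies the Dold condition.
   Context: A sequence of integers $(A_n)_{n\ge1}$ satisfies the Dold condition if $n\mid\sum_{d\mid n}\mu(d)A_{n/d}$ for every $n\in\mathbb{N}_+$ ($\mu$ the Möbius function). For a nonzero integer $m$, $\operatorname{rad}(m)$ denotes the product of the distinct primes dividing $m$. *)

theory Defs
  imports Complex_Main "HOL-Computational_Algebra.Computational_Algebra"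
begin

definition moebius :: "nat \<Rightarrow> int" where
  "moebius n = (if squarefree n then (-1) ^ card (prime_factors n) else 0)"

(* The value A 0 is irrelevant: for n > 0 every index n div d is positive. *)
definition dold :: "(nat \<Rightarrow> int) \<Rightarrow> bool" where
  "dold A \<longleftrightarrow> (\<forall>n>0. int n dvd (\<Sum>d | d dvd n. moebius d * A (n div d)))"

(* Elements of prime_factors m are normalised, i.e. positive primes. *)
definition rad :: "int \<Rightarrow> int" where
  "rad m = \<Prod>(prime_factors m)"

text \<open>The two expressions for the discriminant agree; this also holds for a double root.\<close>

lemma discriminant_eq:
  fixes r1 r2 :: int and \<alpha> \<beta> :: complex
  assumes "{x :: complex. x\<^sup>2 - of_int r1 * x - of_int r2 = 0} = {\<alpha>, \<beta>}"
  shows "(\<alpha> - \<beta>)\<^sup>2 = of_int (r1\<^sup>2 + 4 * r2)"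
proof -
  let ?r = "of_int r1 :: complex" and ?s = "of_int r2 :: complex"
  have root: "x\<^sup>2 - ?r * x - ?s = 0 \<longleftrightarrow> x = \<alpha> \<or> x = \<beta>" for x
    using assms by (auto simp: set_eq_iff)
  have a: "\<alpha>\<^sup>2 - ?r * \<alpha> - ?s = 0"
    using root by blast
  have "(?r - \<alpha>)\<^sup>2 - ?r * (?r - \<alpha>) - ?s = \<alpha>\<^sup>2 - ?r * \<alpha> - ?s"
    by (simp add: power2_eq_square algebra_simps)
  hence A: "?r - \<alpha> = \<alpha> \<or> ?r - \<alpha> = \<beta>"
    using a root[of "?r - \<alpha>"] by simp
  have b: "\<beta>\<^sup>2 - ?r * \<beta> - ?s = 0"
    using root by blast
  have "?r - \<alpha> = \<beta>"
  proof (cases "?r - \<alpha> = \<beta>")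
    case False
    hence r: "?r = 2 * \<alpha>"
      using A by (auto simp: algebra_simps)
    have "(\<beta> - \<alpha>)\<^sup>2 = (\<beta>\<^sup>2 - ?r * \<beta> - ?s) - (\<alpha>\<^sup>2 - ?r * \<alpha> - ?s)"
      by (simp add: r power2_eq_square algebra_simps)
    hence "(\<beta> - \<alpha>)\<^sup>2 = 0"
      by (simp only: a b diff_self)
    thus ?thesis
      using r by simp
  qed
  hence r: "?r = \<alpha> + \<beta>"
    by (simp add: algebra_simps)
  hence s: "?s = - (\<alpha> * \<beta>)"
    using a by (simp add: power2_eq_square algebra_simps)
  show ?thesis
    by (simp add: r s power2_eq_square algebra_simps)
qed

end

theory Submission
  imports Defs "HOL-Number_Theory.Residues"
begin

text \<open>
  A sequence \<open>A\<close> satisfies the Dold condition as soon as \<open>p ^ e\<close> divides \<open>A (p ^ e * m) - A (p ^ (e - 1) * m)\<close>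
  for every prime \<open>p\<close> not dividing \<open>m\<close> and every \<open>e > 0\<close>: in the Moebius sum only the
  divisors \<open>d\<close> and \<open>p * d\<close> with \<open>d\<close> dividing \<open>m\<close> contribute, and they pair up with opposite signs.
  As the discriminant is a square, the roots are integers \<open>a\<close> and \<open>b\<close>, and
  \<open>(a - b) * U n = (U 1 - b * U 0) * (a ^ n - b ^ n) + (a - b) * U 0 * b ^ n\<close>.
  If \<open>p\<close> does not divide \<open>a - b\<close>, the congruence for \<open>U\<close> follows from those for the powers of \<open>a\<close> and \<open>b\<close>.
  If it does, then \<open>(a - b) * p ^ e\<close> divides \<open>a ^ (p ^ e * m) - b ^ (p ^ e * m)\<close>, so the congruence for \<open>U\<close>
  loses at most one factor \<open>p\<close>, which \<open>rad\<close> restores.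
\<close>

section \<open>Moebius sums and the Dold condition\<close>

lemma moebius_prime_mult:
  fixes p d :: nat
  assumes "prime p" "\<not> p dvd d"
  shows "moebius (p * d) = - moebius d"
proof -
  have cop: "coprime p d"
    using assms by (simp add: prime_imp_coprime)
  have "d \<noteq> 0"
    using assms by (metis dvd_0_right)
  have sf: "squarefree (p * d) \<longleftrightarrow> squarefree d"
    using assms cop squarefree_mult_coprime[OF cop] squarefree_multD
    by (metis squarefree_prime prime_imp_prime_elem)
  have "prime_factors (p * d) = insert p (prime_factors d)"
    using assms \<open>d \<noteq> 0\<close> by (subst prime_factors_product) (auto simp: prime_prime_factors)
  moreover have "p \<notin> prime_factors d"
    using assms by auto
  ultimately have "card (prime_factors (p * d)) = Suc (card (prime_factors d))"
    by simp
  then show ?thesis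
    by (simp add: moebius_def sf)
qed

lemma sum_moebius_prime_power:
  fixes p e m :: nat and A :: "nat \<Rightarrow> int"
  assumes p: "prime p" and m: "\<not> p dvd m" and e: "e > 0"
  shows "(\<Sum>d | d dvd p ^ e * m. moebius d * A (p ^ e * m div d)) =
         (\<Sum>d | d dvd m. moebius d * (A (p ^ e * (m div d)) - A (p ^ (e - 1) * (m div d))))"
proof -
  let ?n = "p ^ e * m" and ?D = "{d. d dvd m}"
  let ?f = "\<lambda>d. moebius d * A (?n div d)"
  have "m \<noteq> 0"
    using m by (metis dvd_0_right)
  have "p > 0"
    using p by (rule prime_gt_0_nat)
  \<comment> \<open>Splitting off one \<open>p\<close> turns \<open>?n div (p * d)\<close> into
    \<open>p ^ (e - 1) * (m div d)\<close>.\<close>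
  have n_eq: "?n = p * (p ^ (e - 1) * m)"
    using e by (cases e) auto
  have npd: "\<not> p dvd d" if "d dvd m" for d
    using m that dvd_trans by blast
  have dvd_m: "d dvd m" if "d dvd ?n" "\<not> p dvd d" for d
  proof -
    have "coprime d (p ^ e)"
      using p that by (metis prime_imp_coprime coprime_commute coprime_power_right_iff)
    then show ?thesis
      using that by (simp add: coprime_dvd_mult_right_iff)
  qed
  have finD: "finite ?D"
    using \<open>m \<noteq> 0\<close> by simp
  have fin: "finite {d. d dvd ?n}"
    using \<open>m \<noteq> 0\<close> \<open>p > 0\<close> by (intro finite_divisors_nat) auto
  have "sum ?f {d. d dvd ?n} = sum ?f (?D \<union> (*) p ` ?D)"
  proof (rule sum.mono_neutral_right[OF fin])
    show "?D \<union> (*) p ` ?D \<subseteq> {d. d dvd ?n}"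
      unfolding n_eq by (auto intro: mult_dvd_mono)
    show "\<forall>d \<in> {d. d dvd ?n} - (?D \<union> (*) p ` ?D). ?f d = 0"
    proof (intro ballI)
      fix d
      assume d: "d \<in> {d. d dvd ?n} - (?D \<union> (*) p ` ?D)"
      \<comment> \<open>Were \<open>d\<close> or its cofactor \<open>c\<close> prime to
        \<open>p\<close>, it would divide \<open>m\<close>, putting \<open>d\<close> into one of the
        two removed sets. So \<open>p\<close> divides \<open>d\<close> twice and the Moebius factor
        vanishes.\<close>
      have "p dvd d"
        using d dvd_m by blast
      then obtain c where c: "d = p * c" ..
      have "c dvd ?n"
        using d c by (auto dest: dvd_mult_right)
      then have "p dvd c"
        using d c dvd_m by blast
      then have "p\<^sup>2 dvd d"
        using c by (simp add: power2_eq_square)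
      then have "\<not> squarefree d"
        using p by (auto simp: squarefree_def)
      then show "?f d = 0"
        by (simp add: moebius_def)
    qed
  qed
  also have "\<dots> = sum ?f ?D + sum ?f ((*) p ` ?D)"
    using finD npd by (intro sum.union_disjoint) auto
  also have "sum ?f ?D = (\<Sum>d\<in>?D. moebius d * A (p ^ e * (m div d)))"
    by (intro sum.cong) (auto simp: div_mult_swap)
  also have "sum ?f ((*) p ` ?D) = (\<Sum>d\<in>?D. ?f (p * d))"
    using \<open>p > 0\<close> by (subst sum.reindex) (auto simp: inj_on_def)
  also have "\<dots> = (\<Sum>d\<in>?D. - moebius d * A (p ^ (e - 1) * (m div d)))"
    using p npd \<open>p > 0\<close> by (intro sum.cong) (auto simp: moebius_prime_mult n_eq div_mult_swap)
  finally show ?thesis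
    by (simp add: sum.distrib[symmetric] algebra_simps)
qed

text \<open>Divisibility by \<open>n\<close> is tested one prime at a time: splitting
  \<open>n\<close> as \<open>p ^ e * m\<close> with \<open>e\<close> maximal makes every term of the
  paired sum divisible by \<open>p ^ e\<close>.\<close>

lemma dold_prime_powerI:
  fixes A :: "nat \<Rightarrow> int"
  assumes "\<And>p e m. prime p \<Longrightarrow> e > 0 \<Longrightarrow> \<not> p dvd m \<Longrightarrow>
    int p ^ e dvd A (p ^ e * m) - A (p ^ (e - 1) * m)"
  shows "dold A"
  unfolding dold_def
proof (intro allI impI)
  fix n :: nat
  assume n: "n > 0"
  let ?S = "\<Sum>d | d dvd n. moebius d * A (n div d)"
  have pow: "int (p ^ multiplicity p n) dvd ?S" if p: "prime p" for p
  proof (cases "multiplicity p n = 0")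
    case False
    define e where "e = multiplicity p n"
    obtain m where m: "n = p ^ e * m" "\<not> p dvd m"
      using multiplicity_decompose'[of n p] n p unfolding e_def by (metis not_prime_unit neq0_conv)
    have "\<not> p dvd m div d" if "d dvd m" for d
      using m that by (metis dvd_div_mult_self dvd_mult2)
    moreover have "e > 0"
      using False by (simp add: e_def)
    ultimately have "int p ^ e dvd ?S"
      using m(2) p assms unfolding m(1)
      by (subst sum_moebius_prime_power) (auto intro!: dvd_sum dvd_mult simp del: One_nat_def)
    then show ?thesis
      by (simp add: e_def)
  qed auto
  have "n dvd nat \<bar>?S\<bar>"
  \<comment> \<open>The zero sum is treated apart because \<open>multiplicity p 0\<close> is 0 by
    convention, so comparing multiplicities would fail there.\<close>
  proof (cases "?S = 0")
    case False
    show ?thesis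
    proof (rule multiplicity_le_imp_dvd)
      fix p :: nat
      assume p: "prime p"
      show "multiplicity p n \<le> multiplicity p (nat \<bar>?S\<bar>)"
      proof (rule multiplicity_geI)
        show "p ^ multiplicity p n dvd nat \<bar>?S\<bar>"
          using pow[OF p] by (simp only: int_dvd_int_iff[symmetric] nat_0_le abs_ge_zero dvd_abs_iff)
      qed (use False p not_prime_unit in auto)
    qed (use n in auto)
  qed auto
  then show "int n dvd ?S"
    by (simp only: int_dvd_int_iff[symmetric] nat_0_le abs_ge_zero dvd_abs_iff)
qed

section \<open>Congruences between powers modulo prime powers\<close>

text \<open>Each further \<open>p\<close>-th power gains a factor \<open>p\<close>: the cofactor
  \<open>?s\<close> of \<open>?x - ?y\<close> in \<open>?x ^ p - ?y ^ p\<close> has \<open>p\<close>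
  terms, all congruent to \<open>?y ^ (p - 1)\<close> modulo \<open>p\<close>.\<close>

lemma diff_mult_power_dvd_power_diff:
  fixes x y p :: int
  assumes "p dvd x - y" "p \<ge> 0"
  shows "(x - y) * p ^ e dvd x ^ (nat p ^ e) - y ^ (nat p ^ e)"
proof (induction e)
  case (Suc e)
  let ?q = "nat p ^ e"
  let ?x = "x ^ ?q" and ?y = "y ^ ?q"
  let ?s = "\<Sum>i<nat p. ?y ^ (nat p - Suc i) * ?x ^ i"
  have xy: "[?x = ?y] (mod p)"
    using assms by (intro cong_pow) (simp add: cong_iff_dvd_diff)
  have "[?s = (\<Sum>i<nat p. ?y ^ (nat p - Suc i) * ?y ^ i)] (mod p)"
    by (intro cong_sum cong_mult cong_pow cong_refl xy)
  also have "(\<Sum>i<nat p. ?y ^ (nat p - Suc i) * ?y ^ i) = (\<Sum>i<nat p. ?y ^ (nat p - 1))"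
    by (intro sum.cong) (auto simp: power_add[symmetric])
  also have "\<dots> = p * ?y ^ (nat p - 1)"
    using assms by simp
  finally have "p dvd ?s"
    by (simp add: cong_dvd_iff)
  with Suc have "(x - y) * p ^ e * p dvd (?x - ?y) * ?s"
    by (rule mult_dvd_mono)
  also have "(?x - ?y) * ?s = ?x ^ nat p - ?y ^ nat p"
    by (rule power_diff_sumr2[symmetric])
  finally show ?case
    by (simp add: power_mult[symmetric] mult_ac)
qed auto

text \<open>Fermat's little theorem: Euler's theorem covers \<open>x\<close> coprime to
  \<open>p\<close>, and multiples of \<open>p\<close> are immediate.\<close>

lemma prime_dvd_power_diff_self:
  fixes x :: int and p :: nat
  assumes "prime p"
  shows "int p dvd x ^ p - x"
proof (cases "int p dvd x")
  case True
  then show ?thesis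
    using assms by (intro dvd_diff) (auto intro: dvd_trans[OF _ dvd_power] simp: prime_gt_0_nat)
next
  case False
  then have "coprime x (int p)"
    using assms by (metis coprime_commute prime_imp_coprime prime_nat_int_transfer)
  moreover have "residues (int p)"
    using assms by unfold_locales (metis of_nat_1 of_nat_less_iff prime_gt_1_nat)
  ultimately have "[x ^ totient p = 1] (mod int p)"
    using residues.euler_theorem[of "int p" x] by simp
  then have "[x * x ^ (p - 1) = x * 1] (mod int p)"
    using assms by (intro cong_mult) (auto simp: totient_prime)
  then show ?thesis
    using assms by (cases p) (auto simp: cong_iff_dvd_diff)
qed

text \<open>Fermat makes \<open>?y ^ p\<close> and \<open>?y\<close> congruent modulo
  \<open>p\<close>. Raising both to the power \<open>p ^ (e - 1)\<close> gains \<open>e - 1\<close>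
  further factors \<open>p\<close>.\<close>

lemma prime_power_dvd_power_diff:
  fixes x :: int and p e m :: nat
  assumes "prime p" "e > 0"
  shows "int p ^ e dvd x ^ (p ^ e * m) - x ^ (p ^ (e - 1) * m)"
proof -
  obtain f where f: "e = Suc f"
    using assms by (cases e) auto
  let ?y = "x ^ m"
  have p: "int p dvd ?y ^ p - ?y"
    using assms by (intro prime_dvd_power_diff_self)
  have "int p * int p ^ f dvd (?y ^ p - ?y) * int p ^ f"
    using p by (rule mult_dvd_mono) simp
  also have "\<dots> dvd (?y ^ p) ^ (p ^ f) - ?y ^ (p ^ f)"
    using diff_mult_power_dvd_power_diff[OF p, of f] by simp
  finally show ?thesis
    by (simp add: f power_mult[symmetric] mult_ac)
qed

section \<open>Recurrences with integer characteristic roots\<close>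

text \<open>Both sides solve the recurrence with characteristic roots \<open>a\<close> and
  \<open>b\<close> and agree at 0 and 1. The factor \<open>a - b\<close> on the left keeps the
  formula within the integers.\<close>

lemma linear_recurrence_closed_form:
  fixes a b :: int and U :: "nat \<Rightarrow> int"
  assumes "\<And>n. U (n + 2) = (a + b) * U (n + 1) - a * b * U n"
  shows "(a - b) * U n = (U 1 - b * U 0) * (a ^ n - b ^ n) + (a - b) * U 0 * b ^ n"
proof (induction n rule: induct_nat_012)
  case (ge2 n)
  have U: "U (Suc (Suc n)) = (a + b) * U (Suc n) - a * b * U n"
    using assms[of n] by simp
  have "(a - b) * U (Suc (Suc n)) = (a + b) * ((a - b) * U (Suc n)) - a * b * ((a - b) * U n)"
    unfolding U by (simp add: algebra_simps)
  also have "\<dots> = (U 1 - b * U 0) * (a ^ Suc (Suc n) - b ^ Suc (Suc n)) + (a - b) * U 0 * b ^ Suc (Suc n)"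
    unfolding ge2 by (simp add: algebra_simps)
  finally show ?case .
qed (auto simp: algebra_simps)

lemma dold_rad_linear_recurrence:
  fixes a b c :: int and U :: "nat \<Rightarrow> int"
  assumes U: "\<And>n. U (n + 2) = (a + b) * U (n + 1) - a * b * U n" and "a \<noteq> b"
  shows "dold (\<lambda>n. c * rad ((a - b)\<^sup>2) * U n)"
proof (rule dold_prime_powerI)
  fix p e m :: nat
  assume p: "prime p" and e: "e > 0"
  let ?n = "p ^ e * m" and ?n' = "p ^ (e - 1) * m" and ?R = "rad ((a - b)\<^sup>2)"
  note closed = linear_recurrence_closed_form[OF U]
  have diff: "(a - b) * (U ?n - U ?n') =
      (U 1 - b * U 0) * ((a ^ ?n - b ^ ?n) - (a ^ ?n' - b ^ ?n')) + (a - b) * U 0 * (b ^ ?n - b ^ ?n')"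
    using closed[of ?n] closed[of ?n'] by (simp add: algebra_simps)
  have b: "int p ^ e dvd b ^ ?n - b ^ ?n'"
    using p e by (rule prime_power_dvd_power_diff)
  have "int p ^ e dvd ?R * (U ?n - U ?n')"
  proof (cases "int p dvd a - b")
    case False
    have "int p ^ e dvd (a ^ ?n - a ^ ?n') - (b ^ ?n - b ^ ?n')"
      using b prime_power_dvd_power_diff[OF p e, of a m] by (rule dvd_diff[rotated])
    then have "int p ^ e dvd (a ^ ?n - b ^ ?n) - (a ^ ?n' - b ^ ?n')"
      by (simp add: algebra_simps)
    with b have "int p ^ e dvd (a - b) * (U ?n - U ?n')"
      unfolding diff by (intro dvd_add dvd_mult)
    \<comment> \<open>Here \<open>a - b\<close> can be cancelled without losing any power of
      \<open>p\<close>.\<close>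
    moreover have "coprime (int p ^ e) (a - b)"
      using p False by (simp add: prime_imp_coprime)
    ultimately show ?thesis
      by (simp add: coprime_dvd_mult_right_iff)
  next
    case True
    have pow: "(a - b) * int p ^ f dvd a ^ (p ^ f * m) - b ^ (p ^ f * m)" for f
    proof -
      have "(a - b) * int p ^ f dvd a ^ (p ^ f) - b ^ (p ^ f)"
        using diff_mult_power_dvd_power_diff[OF True, of f] by simp
      also have "\<dots> dvd (a ^ (p ^ f)) ^ m - (b ^ (p ^ f)) ^ m"
        by (simp add: power_diff_sumr2)
      finally show ?thesis
        by (simp add: power_mult)
    qed
    \<comment> \<open>The terms at \<open>?n'\<close> only provide the exponent
      \<open>e - 1\<close>, so those at \<open>?n\<close> are weakened to match before
      \<open>a - b\<close> is cancelled.\<close>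
    have le: "int p ^ (e - 1) dvd int p ^ e"
      by (simp add: le_imp_power_dvd)
    have "(a - b) * int p ^ (e - 1) dvd (a - b) * int p ^ e"
      using le by simp
    then have "(a - b) * int p ^ (e - 1) dvd a ^ ?n - b ^ ?n"
      using pow[of e] by (rule dvd_trans)
    then have "(a - b) * int p ^ (e - 1) dvd (a ^ ?n - b ^ ?n) - (a ^ ?n' - b ^ ?n')"
      using pow[of "e - 1"] by (rule dvd_diff)
    moreover have "(a - b) * int p ^ (e - 1) dvd (a - b) * U 0 * (b ^ ?n - b ^ ?n')"
      using dvd_trans[OF le b] by (intro mult_dvd_mono dvd_mult2) auto
    ultimately have "(a - b) * int p ^ (e - 1) dvd (a - b) * (U ?n - U ?n')"
      unfolding diff by (rule dvd_add[OF dvd_mult])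
    then have U': "int p ^ (e - 1) dvd U ?n - U ?n'"
      using \<open>a \<noteq> b\<close> by simp
    \<comment> \<open>The missing factor \<open>p\<close> comes from \<open>?R\<close>, since
      \<open>p\<close> divides the discriminant.\<close>
    have "int p \<in> prime_factors ((a - b)\<^sup>2)"
      using p True \<open>a \<noteq> b\<close> by (auto simp: in_prime_factors_iff power2_eq_square)
    then have "int p dvd ?R"
      unfolding rad_def by (intro dvd_prod_eqI) auto
    then have "int p * int p ^ (e - 1) dvd ?R * (U ?n - U ?n')"
      using U' by (rule mult_dvd_mono)
    then show ?thesis
      using e by (cases e) auto
  qed
  then have "int p ^ e dvd c * (?R * (U ?n - U ?n'))"
    by (rule dvd_mult)
  then show "int p ^ e dvd c * ?R * U ?n - c * ?R * U ?n'"
    by (simp add: algebra_simps)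
qed

theorem theorem2:
  fixes r1 r2 \<Delta> :: int and U :: "nat \<Rightarrow> int" and \<alpha> \<beta> :: complex
  assumes recurrence: "\<And>n. n \<ge> 2 \<Longrightarrow> U n = r1 * U (n - 1) + r2 * U (n - 2)"
    and roots: "{x :: complex. x\<^sup>2 - of_int r1 * x - of_int r2 = 0} = {\<alpha>, \<beta>}"
    and distinct: "\<alpha> \<noteq> \<beta>"
    and discriminant: "of_int \<Delta> = (\<alpha> - \<beta>)\<^sup>2"
    and square: "\<exists>k :: int. \<Delta> = k\<^sup>2"
  shows "dold (\<lambda>n. r2 * rad \<Delta> * U n)"
proof -
  obtain k where k: "\<Delta> = k\<^sup>2"
    using square by blast
  have "(of_int \<Delta> :: complex) = of_int (r1\<^sup>2 + 4 * r2)"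
    using discriminant discriminant_eq[OF roots] by simp
  then have \<Delta>: "k\<^sup>2 = r1\<^sup>2 + 4 * r2"
    unfolding k of_int_eq_iff .
  have "k \<noteq> 0"
    using discriminant distinct k by auto
  \<comment> \<open>The discriminant is congruent to \<open>r1\<^sup>2\<close> modulo 4, so
    \<open>k\<close> and \<open>r1\<close> have equal parity and the roots
    \<open>(r1 - k) / 2\<close> and \<open>(r1 + k) / 2\<close> are integers, named \<open>b\<close>
    and \<open>a\<close> below.\<close>
  have "even (k\<^sup>2) \<longleftrightarrow> even (r1\<^sup>2)"
    unfolding \<Delta> by simp
  then have "even (r1 - k)"
    by simp
  then obtain b where b: "r1 - k = 2 * b" ..
  define a where "a = b + k"
  have r1: "r1 = a + b"
    using b by (simp add: a_def)
  have k_eq: "k = a - b"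
    by (simp add: a_def)
  have r2: "r2 = - (a * b)"
    using \<Delta> unfolding r1 k_eq by (simp add: power2_eq_square algebra_simps)
  have "U (n + 2) = (a + b) * U (n + 1) - a * b * U n" for n
    using recurrence[of "n + 2"] by (simp add: r1 r2)
  moreover have "a \<noteq> b"
    using \<open>k \<noteq> 0\<close> k_eq by simp
  ultimately show ?thesis
    unfolding k k_eq by (rule dold_rad_linear_recurrence)
qed

end
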